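(* Let $m\geq 3$ and $n\geq 1$ be fixed and let $(B(m,n),\sigma)$ be a signed book graph. Then $(B(m,n),\sigma)$ is switching equivalent to $(B(m,n),\tau)$ for some signature $\tau\subseteq \{uu_{1}^{1},\ldots,uu_{1}^{n}\}$. Further, the number of switching non-isomorphic signed graphs with underlying graph $B(m,n)$ is $n+1$.
   Context: A signed graph $(G,\sigma)$ is a graph $G$ with a sign function $\sigma:E(G)\to\{1,-1\}$; the set of negative edges is also called the signature and denoted $\sigma$. Switching at a vertex $v$ negates the signs of all edges incident to $v$; two signed graphs are switching equivalent if one is obtained from the other by a sequence of switchings. Two signed graphs are isomorphic if there is a graph isomorphism preserving edge signs, and switching isomorphic if one is isomorphic to a switching of the other. For $m\ge 3$, $n\ge 1$, the book graph $B(m,n)$ has vertex set $\{u,v\}\cup\{u_j^i : 1\le i\le n,\ 1\le j\le m-2\}$ and consists of the $n$ cycles (pages) $C_m^i = u u_1^i u_2^i \cdots u_{m-2}^i v u$, $1\le i\le n$, all sharing the common edge $uv$. *)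

theory Defs
  imports Main "HOL-Library.FuncSet"
begin

record 'v graph =
  verts :: "'v set"
  edges :: "'v set set"

definition simple_graph :: "'v graph \<Rightarrow> bool" where
  "simple_graph G \<longleftrightarrow> (\<forall>e\<in>edges G. e \<subseteq> verts G \<and> card e = 2)"

type_synonym 'v signed_graph = "'v graph \<times> ('v set \<Rightarrow> int)"

(* Sign functions are extensional (undefined outside the edge set), so that two signed graphs
   are equal iff they have the same underlying graph and the same signs on its edges. *)
definition signed_graph :: "'v signed_graph \<Rightarrow> bool" where
  "signed_graph = (\<lambda>(G, \<sigma>). simple_graph G \<and> \<sigma> \<in> edges G \<rightarrow>\<^sub>E {1, -1})"

definition signed_graphs_on :: "'v graph \<Rightarrow> 'v signed_graph set" where
  "signed_graphs_on G = {S. signed_graph S \<and> fst S = G}"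

definition signature :: "'v signed_graph \<Rightarrow> 'v set set" where
  "signature = (\<lambda>(G, \<sigma>). {e \<in> edges G. \<sigma> e = -1})"

definition switch_at :: "'v \<Rightarrow> 'v signed_graph \<Rightarrow> 'v signed_graph" where
  "switch_at v = (\<lambda>(G, \<sigma>). (G, \<lambda>e\<in>edges G. if v \<in> e then - \<sigma> e else \<sigma> e))"

definition switching_step :: "'v signed_graph \<Rightarrow> 'v signed_graph \<Rightarrow> bool" where
  "switching_step S T \<longleftrightarrow> (\<exists>v\<in>verts (fst S). T = switch_at v S)"

definition switching_equivalent :: "'v signed_graph \<Rightarrow> 'v signed_graph \<Rightarrow> bool" where
  "switching_equivalent = switching_step\<^sup>*\<^sup>*"

definition signed_isomorphism ::
    "('v \<Rightarrow> 'w) \<Rightarrow> 'v signed_graph \<Rightarrow> 'w signed_graph \<Rightarrow> bool" where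
  "signed_isomorphism f = (\<lambda>(G, \<sigma>) (H, \<tau>).
     bij_betw f (verts G) (verts H) \<and>
     (\<forall>x\<in>verts G. \<forall>y\<in>verts G. {x, y} \<in> edges G \<longleftrightarrow> {f x, f y} \<in> edges H) \<and>
     (\<forall>e\<in>edges G. \<tau> (f ` e) = \<sigma> e))"

definition signed_isomorphic :: "'v signed_graph \<Rightarrow> 'w signed_graph \<Rightarrow> bool" where
  "signed_isomorphic S T \<longleftrightarrow> (\<exists>f. signed_isomorphism f S T)"

definition switching_isomorphic :: "'v signed_graph \<Rightarrow> 'w signed_graph \<Rightarrow> bool" where
  "switching_isomorphic S T \<longleftrightarrow> (\<exists>T'. switching_equivalent T T' \<and> signed_isomorphic S T')"

(* Restricted to the signed graphs on G: this is what makes the quotient by it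
   the set of switching isomorphism classes (see equiv_switching_isomorphism_on). *)
definition switching_isomorphism_on :: "'v graph \<Rightarrow> 'v signed_graph rel" where
  "switching_isomorphism_on G =
     {(S, T). S \<in> signed_graphs_on G \<and> T \<in> signed_graphs_on G \<and> switching_isomorphic S T}"

(* W i j is the vertex u_j^i, the j-th inner vertex of the i-th page. *)
datatype book_vertex = U | V | W nat nat

definition cycle_edges :: "'v list \<Rightarrow> 'v set set" where
  "cycle_edges xs = {{xs ! k, xs ! (Suc k mod length xs)} |k. k < length xs}"

definition page :: "nat \<Rightarrow> nat \<Rightarrow> book_vertex list" where
  "page m i = U # map (W i) [1..<m - 1] @ [V]"

definition book_graph :: "nat \<Rightarrow> nat \<Rightarrow> book_vertex graph" where
  "book_graph m n =
     \<lparr>verts = {U, V} \<union> {W i j |i j. i \<in> {1..n} \<and> j \<in> {1..m - 2}},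
      edges = (\<Union>i\<in>{1..n}. cycle_edges (page m i))\<rparr>"

lemma page_cycle:
  assumes "m \<ge> 3"
  shows "length (page m i) = m" "distinct (page m i)"
    "set (page m i) = {U, V} \<union> {W i j |j. j \<in> {1..m - 2}}"
proof -
  show "length (page m i) = m" using assms by (simp add: page_def)
  show "distinct (page m i)" by (auto simp: page_def distinct_map inj_on_def)
  have "{1..<m - 1} = {1..m - 2}" using assms by auto
  then show "set (page m i) = {U, V} \<union> {W i j |j. j \<in> {1..m - 2}}"
    by (auto simp: page_def)
qed

lemma simple_book_graph:
  assumes "m \<ge> 3"
  shows "simple_graph (book_graph m n)"
  unfolding simple_graph_def
proof
  fix e assume "e \<in> edges (book_graph m n)"
  then obtain i k where i: "i \<in> {1..n}" and k: "k < m"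
    and e: "e = {page m i ! k, page m i ! (Suc k mod m)}"
    using page_cycle(1)[OF assms] by (auto simp: book_graph_def cycle_edges_def)
  have k': "Suc k mod m < m" using assms by simp
  have "Suc k mod m \<noteq> k" using assms k by (cases "Suc k = m") auto
  then have "page m i ! k \<noteq> page m i ! (Suc k mod m)"
    using page_cycle(1,2)[OF assms, of i] k k' by (metis nth_eq_iff_index_eq)
  then have "card e = 2" using e by simp
  moreover have "e \<subseteq> set (page m i)"
    using e k k' page_cycle(1)[OF assms, of i] by auto
  then have "e \<subseteq> verts (book_graph m n)"
    using i page_cycle(3)[OF assms, of i] by (auto simp: book_graph_def)
  ultimately show "e \<subseteq> verts (book_graph m n) \<and> card e = 2" by blast
qed

lemma signed_graph_switch_at:
  "signed_graph S \<Longrightarrow> signed_graph (switch_at v S)"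
  unfolding signed_graph_def switch_at_def by (fastforce split: prod.splits)

lemma fst_switch_at [simp]: "fst (switch_at v S) = fst S"
  by (simp add: switch_at_def split: prod.splits)

lemma switch_at_switch_at:
  assumes "signed_graph S"
  shows "switch_at v (switch_at v S) = S"
  using assms unfolding signed_graph_def switch_at_def
  by (auto split: prod.splits simp: fun_eq_iff PiE_def extensional_def)

lemma switching_equivalent_signed_graph:
  assumes "switching_equivalent S T" "signed_graph S"
  shows "signed_graph T \<and> fst T = fst S"
  using assms unfolding switching_equivalent_def
  by (induction rule: rtranclp_induct) (auto simp: switching_step_def signed_graph_switch_at)

lemma switching_equivalent_sym:
  assumes "switching_equivalent S T" "signed_graph S"
  shows "switching_equivalent T S"
  using assms unfolding switching_equivalent_def
proof (induction rule: rtranclp_induct)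
  case base
  then show ?case by simp
next
  case (step T T')
  then have T: "signed_graph T" "fst T = fst S"
    using switching_equivalent_signed_graph[of S T]
    by (simp_all add: switching_equivalent_def)
  obtain v where "v \<in> verts (fst T)" "T' = switch_at v T"
    using step.hyps(2) by (auto simp: switching_step_def)
  then have "switching_step T' T"
    using T switch_at_switch_at[of T v] unfolding switching_step_def by (metis fst_switch_at)
  then show ?case using step by (meson converse_rtranclp_into_rtranclp)
qed

lemma simple_edgeE:
  assumes "simple_graph G" "e \<in> edges G"
  obtains x y where "x \<in> verts G" "y \<in> verts G" "e = {x, y}"
  using assms unfolding simple_graph_def by (metis card_2_iff insert_subset)

lemma signed_isomorphism_switch_at:
  assumes f: "signed_isomorphism f S T" and S: "signed_graph S" and v: "v \<in> verts (fst S)"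
  shows "signed_isomorphism f (switch_at v S) (switch_at (f v) T)"
proof -
  obtain G \<sigma> H \<tau> where [simp]: "S = (G, \<sigma>)" "T = (H, \<tau>)" by fastforce
  have inj: "inj_on f (verts G)"
    using f by (auto simp: signed_isomorphism_def bij_betw_def)
  have "f ` e \<in> edges H \<and> e \<subseteq> verts G \<and> (f v \<in> f ` e \<longleftrightarrow> v \<in> e)" if e: "e \<in> edges G" for e
  proof -
    obtain x y where xy: "x \<in> verts G" "y \<in> verts G" "e = {x, y}"
      using S e by (auto simp: signed_graph_def elim: simple_edgeE)
    then show ?thesis
      using f e v inj by (auto simp: signed_isomorphism_def dest: inj_onD)
  qed
  then show ?thesis using f by (auto simp: signed_isomorphism_def switch_at_def)
qed

lemma signed_isomorphic_switching:
  assumes "switching_equivalent S S'" "signed_graph S" "signed_isomorphic S T"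
  shows "\<exists>T'. switching_equivalent T T' \<and> signed_isomorphic S' T'"
  using assms unfolding switching_equivalent_def
proof (induction rule: rtranclp_induct)
  case base
  then show ?case by blast
next
  case (step R R')
  then obtain T' f where T': "switching_step\<^sup>*\<^sup>* T T'" and f: "signed_isomorphism f R T'"
    by (auto simp: signed_isomorphic_def)
  have R: "signed_graph R"
    using step.hyps(1) step.prems(1) switching_equivalent_signed_graph
    unfolding switching_equivalent_def by blast
  obtain v where v: "v \<in> verts (fst R)" "R' = switch_at v R"
    using step.hyps(2) by (auto simp: switching_step_def)
  have "f v \<in> verts (fst T')"
    using f v by (auto simp: signed_isomorphism_def bij_betw_def split: prod.splits)
  then have "switching_step T' (switch_at (f v) T')" by (auto simp: switching_step_def)
  then show ?case
    using T' v(2) signed_isomorphism_switch_at[OF f R v(1)]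
    unfolding signed_isomorphic_def by (meson rtranclp.rtrancl_into_rtrancl)
qed

lemma signed_isomorphic_sym:
  assumes "signed_isomorphic S T" "signed_graph T"
  shows "signed_isomorphic T S"
proof -
  obtain f where f: "signed_isomorphism f S T" using assms by (auto simp: signed_isomorphic_def)
  obtain G \<sigma> H \<tau> where [simp]: "S = (G, \<sigma>)" "T = (H, \<tau>)" by fastforce
  define g where "g = inv_into (verts G) f"
  have bij: "bij_betw f (verts G) (verts H)" using f by (simp add: signed_isomorphism_def)
  have g: "bij_betw g (verts H) (verts G)" unfolding g_def by (rule bij_betw_inv_into[OF bij])
  have fg: "f (g x) = x" "g x \<in> verts G" if "x \<in> verts H" for x
    using that bij g unfolding g_def
    by (auto simp: bij_betw_inv_into_right bij_betw_apply)
  have E: "{x, y} \<in> edges H \<longleftrightarrow> {g x, g y} \<in> edges G" if "x \<in> verts H" "y \<in> verts H" for x y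
    using f fg[OF that(1)] fg[OF that(2)] by (auto simp: signed_isomorphism_def)
  have "\<sigma> (g ` e) = \<tau> e" if e: "e \<in> edges H" for e
  proof -
    obtain x y where xy: "x \<in> verts H" "y \<in> verts H" "e = {x, y}"
      using assms(2) e by (auto simp: signed_graph_def elim: simple_edgeE)
    then have "g ` e \<in> edges G" "f ` g ` e = e" using E e fg by auto
    then show ?thesis using f by (force simp: signed_isomorphism_def)
  qed
  then have "signed_isomorphism g T S" using g E by (simp add: signed_isomorphism_def)
  then show ?thesis by (auto simp: signed_isomorphic_def)
qed

lemma signed_isomorphic_trans:
  assumes "signed_isomorphic R S" "signed_isomorphic S T" "signed_graph R"
  shows "signed_isomorphic R T"
proof -
  obtain f g where f: "signed_isomorphism f R S" and g: "signed_isomorphism g S T"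
    using assms by (auto simp: signed_isomorphic_def)
  obtain F \<rho> G \<sigma> H \<tau> where [simp]: "R = (F, \<rho>)" "S = (G, \<sigma>)" "T = (H, \<tau>)" by (metis surj_pair)
  have b: "bij_betw f (verts F) (verts G)" using f by (simp add: signed_isomorphism_def)
  have "\<tau> ((g \<circ> f) ` e) = \<rho> e" if e: "e \<in> edges F" for e
  proof -
    obtain x y where xy: "x \<in> verts F" "y \<in> verts F" "e = {x, y}"
      using assms(3) e by (auto simp: signed_graph_def elim: simple_edgeE)
    then have "f ` e \<in> edges G" using f e by (auto simp: signed_isomorphism_def)
    then have "\<tau> (g ` f ` e) = \<rho> e" using f g e by (simp add: signed_isomorphism_def)
    then show ?thesis by (simp add: image_comp)
  qed
  moreover have "bij_betw (g \<circ> f) (verts F) (verts H)"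
    using f g by (auto simp: signed_isomorphism_def intro: bij_betw_trans)
  ultimately have "signed_isomorphism (g \<circ> f) R T"
    using f g bij_betw_apply[OF b] by (simp add: signed_isomorphism_def)
  then show ?thesis by (auto simp: signed_isomorphic_def)
qed

lemma signed_isomorphic_refl: "signed_isomorphic S S"
  by (auto simp: signed_isomorphic_def signed_isomorphism_def split: prod.splits
      intro!: exI[of _ id])

lemma switching_isomorphic_sym:
  assumes "switching_isomorphic S T" "signed_graph S" "signed_graph T"
  shows "switching_isomorphic T S"
proof -
  obtain T' where T': "switching_equivalent T T'" "signed_isomorphic S T'"
    using assms by (auto simp: switching_isomorphic_def)
  have t: "signed_graph T'" using T' assms switching_equivalent_signed_graph by blast
  have "switching_equivalent T' T" using switching_equivalent_sym T' assms by blast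
  then show ?thesis
    using signed_isomorphic_switching[OF _ t signed_isomorphic_sym[OF T'(2) t]]
    unfolding switching_isomorphic_def by blast
qed

lemma switching_isomorphic_trans:
  assumes "switching_isomorphic R S" "switching_isomorphic S T"
    and "signed_graph R" "signed_graph S"
  shows "switching_isomorphic R T"
proof -
  obtain S' T' where S': "switching_equivalent S S'" "signed_isomorphic R S'"
    and T': "switching_equivalent T T'" "signed_isomorphic S T'"
    using assms by (auto simp: switching_isomorphic_def)
  obtain T'' where T'': "switching_equivalent T' T''" "signed_isomorphic S' T''"
    using signed_isomorphic_switching S' T' assms by blast
  have "switching_equivalent T T''"
    using T' T'' by (auto simp: switching_equivalent_def)
  then show ?thesis
    using signed_isomorphic_trans[OF S'(2) T''(2)] assms(3)
    unfolding switching_isomorphic_def by blast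
qed

lemma equiv_switching_isomorphism_on:
  "equiv (signed_graphs_on G) (switching_isomorphism_on G)"
proof (rule equivI)
  show "switching_isomorphism_on G \<subseteq> signed_graphs_on G \<times> signed_graphs_on G"
    by (auto simp: switching_isomorphism_on_def)
  show "refl_on (signed_graphs_on G) (switching_isomorphism_on G)"
    by (auto simp: refl_on_def switching_isomorphism_on_def switching_isomorphic_def
        switching_equivalent_def intro: signed_isomorphic_refl)
  show "sym (switching_isomorphism_on G)"
    by (auto simp: sym_def switching_isomorphism_on_def signed_graphs_on_def
        intro: switching_isomorphic_sym)
  show "trans (switching_isomorphism_on G)"
    by (auto simp: trans_def switching_isomorphism_on_def signed_graphs_on_def
        intro: switching_isomorphic_trans)
qed

end

theory Submission imports Defs begin

text \<open>
  Every signature can be switched so that the edges of the spanning tree omitting the first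
  edges of the pages are positive; permuting pages shows that the number of negative pages
  then determines the signed graph up to isomorphism. Conversely, switching preserves the sign
  of every edge set with all degrees even. The even edge sets of a book graph are unions of full
  page paths, possibly with the edge UV, so those of size m are exactly the pages (two page paths
  already have 2(m - 1) > m edges). Being described without reference to the page structure,
  the number of negative even edge sets of size m is a switching isomorphism invariant
  with values 0, ..., n.
\<close>

section \<open>Counting classes by a complete invariant; matching subsets by a permutation\<close>

text \<open>The classes are exactly the nonempty fibres of \<open>f\<close>, and a nonempty fibre
  determines its value.\<close>

lemma card_quotient_eq_card_image:
  assumes "equiv A r" and "\<And>x y. x \<in> A \<Longrightarrow> y \<in> A \<Longrightarrow> (x, y) \<in> r \<longleftrightarrow> f x = f y"
  shows "card (A // r) = card (f ` A)"
proof -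
  have cls: "r `` {x} = {y \<in> A. f y = f x}" if "x \<in> A" for x
    using assms that by (auto simp: equiv_def)
  have "A // r = (\<lambda>c. {y \<in> A. f y = c}) ` f ` A"
    unfolding quotient_def by (auto simp: cls)
  moreover have "inj_on (\<lambda>c. {y \<in> A. f y = c}) (f ` A)"
    by (rule inj_onI) blast
  ultimately show ?thesis by (simp add: card_image)
qed

text \<open>In a finite set the complements of \<open>P\<close> and \<open>Q\<close> also have equal
  size, so a bijection of \<open>P\<close> onto \<open>Q\<close> and one of the complements can be
  glued. This later supplies the permutation of the pages.\<close>

lemma permutation_between_subsets:
  assumes "finite A" "P \<subseteq> A" "Q \<subseteq> A" "card P = card Q"
  obtains \<pi> where "bij_betw \<pi> A A" "\<pi> ` P = Q"
proof -
  have fin: "finite P" "finite Q" using assms finite_subset by blast+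
  obtain g where g: "bij_betw g P Q"
    using fin assms(4) finite_same_card_bij by blast
  have "card (A - P) = card (A - Q)" using assms fin by (simp add: card_Diff_subset)
  then obtain h where h: "bij_betw h (A - P) (A - Q)"
    using assms(1) finite_same_card_bij by blast
  let ?p = "\<lambda>x. if x \<in> P then g x else h x"
  have "bij_betw ?p (P \<union> (A - P)) (Q \<union> (A - Q))"
    using g h by (rule bij_betw_disjoint_Un) auto
  then have "bij_betw ?p A A" using assms(2,3) by (simp add: Un_absorb1)
  moreover have "?p ` P = Q" using g by (auto simp: bij_betw_def)
  ultimately show ?thesis using that by blast
qed

section \<open>Switching a set of vertices\<close>

text \<open>Switching the vertices of \<open>X\<close> one after the other negates an edge once for
  each of its ends in \<open>X\<close>.\<close>

lemma switching_equivalent_switch_set: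
  assumes "finite X" "X \<subseteq> verts G" "\<sigma> \<in> extensional (edges G)" "\<And>e. e \<in> edges G \<Longrightarrow> finite e"
  shows "switching_equivalent (G, \<sigma>) (G, \<lambda>e\<in>edges G. (-1) ^ card (e \<inter> X) * \<sigma> e)"
  using assms(1,2)
proof (induction X rule: finite_induct)
  case empty
  \<comment> \<open>Extensionality of \<open>\<sigma>\<close> makes the restricted function equal to
    \<open>\<sigma>\<close> itself.\<close>
  have "(\<lambda>e\<in>edges G. (-1) ^ card (e \<inter> {}) * \<sigma> e) = \<sigma>"
    using assms(3) by (auto simp: fun_eq_iff extensional_def)
  then show ?case by (simp add: switching_equivalent_def)
next
  case (insert v X)
  let ?S = "\<lambda>X. (G, \<lambda>e\<in>edges G. (-1) ^ card (e \<inter> X) * \<sigma> e)"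
  have "card (e \<inter> insert v X) = (if v \<in> e then Suc (card (e \<inter> X)) else card (e \<inter> X))"
    if "e \<in> edges G" for e
    using insert.hyps that assms(4) by auto
  then have "?S (insert v X) = switch_at v (?S X)"
    by (auto simp: switch_at_def fun_eq_iff)
  then have "switching_step (?S X) (?S (insert v X))"
    unfolding switching_step_def using insert.prems by (intro bexI[of _ v]) simp_all
  moreover have "switching_equivalent (G, \<sigma>) (?S X)"
    using insert.prems insert.IH by blast
  ultimately show ?case
    unfolding switching_equivalent_def by (rule rtranclp.rtrancl_into_rtrancl[rotated])
qed

text \<open>The multiplicative form of switching the set where \<open>s\<close> is -1. It allows a
  switching to be given by a sign formula for the vertices.\<close>

lemma switching_equivalent_switch_fun:
  assumes G: "simple_graph G" "finite (verts G)" "\<sigma> \<in> extensional (edges G)"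
    and s: "\<And>v. v \<in> verts G \<Longrightarrow> s v \<in> {1, -1 :: int}"
  shows "switching_equivalent (G, \<sigma>) (G, \<lambda>e\<in>edges G. prod s e * \<sigma> e)"
proof -
  let ?X = "{v \<in> verts G. s v = -1}"
  have fin: "finite e" if "e \<in> edges G" for e
    using G that by (auto simp: simple_graph_def intro: finite_subset)
  have "prod s e = (-1) ^ card (e \<inter> ?X)" if e: "e \<in> edges G" for e
  proof -
    have sub: "e \<subseteq> verts G" using G e by (simp add: simple_graph_def)
    have "prod s e = (\<Prod>v\<in>e. if v \<in> ?X then -1 else 1)"
      using sub s by (intro prod.cong) auto
    also have "\<dots> = (\<Prod>v\<in>e \<inter> ?X. -1)"
      using fin[OF e] by (rule prod.inter_restrict[symmetric])
    finally show ?thesis by simp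
  qed
  then have "(\<lambda>e\<in>edges G. prod s e * \<sigma> e) = (\<lambda>e\<in>edges G. (-1) ^ card (e \<inter> ?X) * \<sigma> e)"
    by (auto simp: fun_eq_iff)
  then show ?thesis
    using switching_equivalent_switch_set[of ?X G \<sigma>] G fin by simp
qed

section \<open>Negative even edge sets\<close>

text \<open>For a finite simple graph these are the elements of the cycle space over the field with
  two elements.\<close>

definition even_edge_set :: "'v graph \<Rightarrow> 'v set set \<Rightarrow> bool" where
  "even_edge_set G F \<longleftrightarrow> F \<subseteq> edges G \<and> (\<forall>v\<in>verts G. even (card {e \<in> F. v \<in> e}))"

definition negative_even_sets :: "nat \<Rightarrow> 'v signed_graph \<Rightarrow> 'v set set set" where
  "negative_even_sets m = (\<lambda>(G, \<sigma>). {F. even_edge_set G F \<and> card F = m \<and> prod \<sigma> F = -1})"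

text \<open>The product picks up a factor -1 for each edge of \<open>F\<close> at \<open>v\<close>,
  and the number of these is even.\<close>

lemma prod_switch_at_even:
  assumes "even_edge_set G F" "v \<in> verts G" "finite (edges G)"
  shows "prod (snd (switch_at v (G, \<sigma>))) F = prod \<sigma> F"
proof -
  have F: "F \<subseteq> edges G" "finite F" "even (card {e \<in> F. v \<in> e})"
    using assms by (auto simp: even_edge_set_def intro: finite_subset)
  have "prod (snd (switch_at v (G, \<sigma>))) F = (\<Prod>e\<in>F. (if v \<in> e then -1 else 1) * \<sigma> e)"
    using F by (intro prod.cong) (auto simp: switch_at_def)
  also have "\<dots> = (\<Prod>e\<in>F. if v \<in> e then -1 else 1) * prod \<sigma> F"
    by (rule prod.distrib)
  also have "(\<Prod>e\<in>F. if v \<in> e then -1 else 1 :: int) = (-1) ^ card {e \<in> F. v \<in> e}"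
    using F(2) by (simp flip: prod.inter_filter)
  finally show ?thesis using F(3) by simp
qed

text \<open>Evenness and size depend on the graph alone, so only the sign product has to be
  followed. The clause on \<open>fst\<close> carries the graph, and with it finiteness, through the
  induction.\<close>

lemma negative_even_sets_switching:
  assumes "switching_equivalent S T" "finite (edges (fst S))"
  shows "negative_even_sets m T = negative_even_sets m S \<and> fst T = fst S"
  using assms unfolding switching_equivalent_def
proof (induction rule: rtranclp_induct)
  case base
  then show ?case by simp
next
  case (step T T')
  obtain G \<sigma> where T: "T = (G, \<sigma>)" by fastforce
  obtain v where v: "v \<in> verts G" "T' = switch_at v T"
    using step.hyps(2) T by (auto simp: switching_step_def)
  have G: "finite (edges G)" using step T by simp
  have "T' = (G, snd (switch_at v (G, \<sigma>)))" using v T by (simp add: switch_at_def)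
  then have "negative_even_sets m T' = negative_even_sets m T"
    using prod_switch_at_even[OF _ v(1) G, of _ \<sigma>] T by (auto simp: negative_even_sets_def)
  then show ?case using step v by simp
qed

text \<open>The map \<open>f\<close> acts injectively on vertices, hence on edges, hence on edge
  sets, and it preserves degrees, sizes and signs. An inequality suffices, since the inverse
  isomorphism gives the other one.\<close>

lemma card_negative_even_sets_le:
  assumes S: "signed_graph S" and f: "signed_isomorphism f S T" and fin: "finite (edges (fst T))"
  shows "card (negative_even_sets m S) \<le> card (negative_even_sets m T)"
proof -
  obtain G \<sigma> H \<tau> where [simp]: "S = (G, \<sigma>)" "T = (H, \<tau>)" by fastforce
  have bij: "bij_betw f (verts G) (verts H)" using f by (simp add: signed_isomorphism_def)
  then have inj: "inj_on f (verts G)" by (rule bij_betw_imp_inj_on)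
  have E: "e \<subseteq> verts G" "f ` e \<in> edges H" "\<tau> (f ` e) = \<sigma> e" if e: "e \<in> edges G" for e
  proof -
    obtain x y where xy: "x \<in> verts G" "y \<in> verts G" "e = {x, y}"
      using S e by (auto simp: signed_graph_def elim: simple_edgeE)
    then show "e \<subseteq> verts G" by simp
    have "{f x, f y} \<in> edges H" using f e xy by (simp add: signed_isomorphism_def)
    then show "f ` e \<in> edges H" using xy by simp
    show "\<tau> (f ` e) = \<sigma> e" using f e by (simp add: signed_isomorphism_def)
  qed
  have injE: "inj_on ((`) f) (edges G)"
    using inj_on_image_Pow[OF inj] by (rule inj_on_subset) (use E in auto)
  let ?g = "(`) ((`) f)"
  have "?g F \<in> negative_even_sets m T" if "F \<in> negative_even_sets m S" for F
  proof -
    have F: "F \<subseteq> edges G" "\<And>v. v \<in> verts G \<Longrightarrow> even (card {e \<in> F. v \<in> e})"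
      "card F = m" "prod \<sigma> F = -1"
      using that by (auto simp: negative_even_sets_def even_edge_set_def)
    have injF: "inj_on ((`) f) F" using injE F(1) inj_on_subset by blast
    \<comment> \<open>The edges of the image at \<open>f v\<close> are the images of the edges of
      \<open>F\<close> at \<open>v\<close>.\<close>
    have "even (card {e \<in> ?g F. w \<in> e})" if w: "w \<in> verts H" for w
    proof -
      obtain v where v: "v \<in> verts G" "w = f v" using w bij by (auto simp: bij_betw_def)
      have "f v \<in> f ` e \<longleftrightarrow> v \<in> e" if "e \<in> F" for e
        using inj_on_image_mem_iff[OF inj v(1)] E(1) F(1) that by blast
      then have "{e \<in> ?g F. w \<in> e} = ?g {e \<in> F. v \<in> e}" unfolding v(2) by auto
      moreover have "inj_on ((`) f) {e \<in> F. v \<in> e}" using injF by (rule inj_on_subset) auto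
      ultimately show ?thesis using F(2)[OF v(1)] by (simp add: card_image)
    qed
    moreover have "prod \<tau> (?g F) = prod \<sigma> F"
      unfolding prod.reindex[OF injF] using E(3) F(1) by (intro prod.cong) auto
    ultimately show ?thesis
      using F E(2) injF by (auto simp: negative_even_sets_def even_edge_set_def card_image)
  qed
  moreover have "inj_on ?g (negative_even_sets m S)"
    using inj_on_image_Pow[OF injE]
    by (rule inj_on_subset) (auto simp: negative_even_sets_def even_edge_set_def)
  moreover have "negative_even_sets m T \<subseteq> Pow (edges H)"
    by (auto simp: negative_even_sets_def even_edge_set_def)
  then have "finite (negative_even_sets m T)"
    using fin finite_subset by fastforce
  ultimately show ?thesis by (intro card_inj_on_le[of ?g]) auto
qed

lemma card_negative_even_sets_switching_isomorphic:
  assumes "switching_isomorphic S T" "signed_graph S" "signed_graph T"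
    and "finite (edges (fst S))" "finite (edges (fst T))"
  shows "card (negative_even_sets m S) = card (negative_even_sets m T)"
proof -
  obtain T' where T': "switching_equivalent T T'" "signed_isomorphic S T'"
    using assms(1) by (auto simp: switching_isomorphic_def)
  have T: "negative_even_sets m T' = negative_even_sets m T" "fst T' = fst T" "signed_graph T'"
    using negative_even_sets_switching[OF T'(1) assms(5)]
      switching_equivalent_signed_graph[OF T'(1) assms(3)] by auto
  obtain f g where "signed_isomorphism f S T'" "signed_isomorphism g T' S"
    using T'(2) signed_isomorphic_sym[OF T'(2) T(3)] by (auto simp: signed_isomorphic_def)
  then have "card (negative_even_sets m S) = card (negative_even_sets m T')"
    using card_negative_even_sets_le assms T by (metis le_antisym)
  then show ?thesis using T by simp
qed

section \<open>The edges of the book graph\<close>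

text \<open>Numbers the vertices of a page from \<open>U\<close> at 0 to \<open>V\<close> at
  \<open>m - 1\<close>, so that end vertices and inner vertices are treated alike. Only indices
  below \<open>m\<close> are meaningful.\<close>

definition path_vertex :: "nat \<Rightarrow> nat \<Rightarrow> nat \<Rightarrow> book_vertex" where
  "path_vertex m i k = (if k = 0 then U else if k = m - 1 then V else W i k)"

definition path_edge :: "nat \<Rightarrow> nat \<Rightarrow> nat \<Rightarrow> book_vertex set" where
  "path_edge m i k = {path_vertex m i k, path_vertex m i (Suc k)}"

lemma page_nth:
  assumes "m \<ge> 3" "k < m"
  shows "page m i ! k = path_vertex m i k"
  using assms by (auto simp: page_def path_vertex_def nth_Cons nth_append split: nat.splits)

text \<open>Separates the edge shared by all pages from the \<open>m - 1\<close> edges private to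
  one page.\<close>

lemma cycle_edges_page:
  assumes "m \<ge> 3"
  shows "cycle_edges (page m i) = insert {U, V} (path_edge m i ` {..<m - 1})"
proof -
  \<comment> \<open>The last index is the one whose successor wraps around to 0; it yields the edge
    from \<open>V\<close> back to \<open>U\<close>.\<close>
  have split: "{..<m} = insert (m - 1) {..<m - 1}" using assms by auto
  have "cycle_edges (page m i) =
      (\<lambda>k. {path_vertex m i k, path_vertex m i (Suc k mod m)}) ` {..<m}"
  proof -
    have "{page m i ! k, page m i ! (Suc k mod m)} =
        {path_vertex m i k, path_vertex m i (Suc k mod m)}" if "k < m" for k
      using that assms by (simp add: page_nth)
    then show ?thesis
      unfolding cycle_edges_def page_cycle(1)[OF assms] by blast
  qed
  also have "\<dots> = insert {U, V} (path_edge m i ` {..<m - 1})"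
    unfolding split using assms by (auto simp: path_edge_def path_vertex_def image_def)
  finally show ?thesis .
qed

text \<open>The shared edge comes from the pages, so at least one page must exist.\<close>

lemma edges_book_graph:
  assumes "m \<ge> 3" "n \<ge> 1"
  shows "edges (book_graph m n) = insert {U, V} (\<Union>i\<in>{1..n}. path_edge m i ` {..<m - 1})"
  using assms by (auto simp: book_graph_def cycle_edges_page)

lemma path_edge_0:
  assumes "m \<ge> 3"
  shows "path_edge m i 0 = {U, W i 1}"
  using assms by (auto simp: path_edge_def path_vertex_def)

lemma mem_path_edge:
  assumes "m \<ge> 3" "k < m - 1"
  shows "U \<in> path_edge m i k \<longleftrightarrow> k = 0"
    and "V \<in> path_edge m i k \<longleftrightarrow> k = m - 2"
    and "1 \<le> j \<Longrightarrow> j \<le> m - 2 \<Longrightarrow> W i' j \<in> path_edge m i k \<longleftrightarrow> i' = i \<and> (k = j \<or> k = j - 1)"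
  using assms by (auto simp: path_edge_def path_vertex_def)

text \<open>Since \<open>m \<ge> 3\<close>, every path edge has an inner vertex, and this carries
  the page number; the two ends together give the position.\<close>

lemma path_edge_inject:
  assumes "m \<ge> 3" "k < m - 1" "k' < m - 1"
  shows "path_edge m i k = path_edge m i' k' \<longleftrightarrow> i = i' \<and> k = k'"
proof -
  have "i = i' \<and> k = k'" if eq: "path_edge m i k = path_edge m i' k'"
    using assms eq by (auto simp: path_edge_def path_vertex_def doubleton_eq_iff split: if_splits)
  then show ?thesis by blast
qed

lemma path_edge_neq_UV:
  assumes "m \<ge> 3" "k < m - 1"
  shows "path_edge m i k \<noteq> {U, V}"
  using assms by (auto simp: path_edge_def path_vertex_def doubleton_eq_iff)

lemma inj_on_path_edge:
  assumes "m \<ge> 3"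
  shows "inj_on (path_edge m i) {..<m - 1}"
  using assms by (auto simp: inj_on_def path_edge_inject)

lemma card_path_edges:
  assumes "m \<ge> 3"
  shows "card (path_edge m i ` {..<m - 1}) = m - 1"
  using card_image[OF inj_on_path_edge[OF assms, of i]] by simp

lemma card_cycle_edges_page:
  assumes "m \<ge> 3"
  shows "card (cycle_edges (page m i)) = m"
proof -
  have "{U, V} \<notin> path_edge m i ` {..<m - 1}"
    using path_edge_neq_UV[OF assms] by fastforce
  then show ?thesis
    using assms by (simp add: cycle_edges_page card_path_edges del: One_nat_def)
qed

lemma path_edge_mem_page_iff:
  assumes m: "m \<ge> 3" and k: "k < m - 1"
  shows "path_edge m i k \<in> cycle_edges (page m i') \<longleftrightarrow> i = i'"
proof
  assume "path_edge m i k \<in> cycle_edges (page m i')"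
  then obtain k' where k': "k' < m - 1" "path_edge m i k = path_edge m i' k'"
    using path_edge_neq_UV[OF m k] unfolding cycle_edges_page[OF m] by blast
  show "i = i'" using path_edge_inject[OF m k k'(1)] k'(2) by blast
next
  assume "i = i'"
  then show "path_edge m i k \<in> cycle_edges (page m i')"
    using k unfolding cycle_edges_page[OF m] by blast
qed

lemma inj_cycle_edges_page:
  assumes "m \<ge> 3"
  shows "inj (\<lambda>i. cycle_edges (page m i))"
proof (rule injI)
  fix i i' assume eq: "cycle_edges (page m i) = cycle_edges (page m i')"
  \<comment> \<open>The path edge at position 0 exists and tells the two pages apart.\<close>
  have "0 < m - 1" using assms by simp
  then show "i = i'"
    using eq path_edge_mem_page_iff[OF assms] by metis
qed

lemma finite_book_graph:
  shows "finite (verts (book_graph m n))" "finite (edges (book_graph m n))"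
proof -
  have "{W i j |i j. i \<in> {1..n} \<and> j \<in> {1..m - 2}} = (\<lambda>(i, j). W i j) ` ({1..n} \<times> {1..m - 2})"
    by auto
  then show "finite (verts (book_graph m n))" by (simp add: book_graph_def)
  have "cycle_edges xs = (\<lambda>k. {xs ! k, xs ! (Suc k mod length xs)}) ` {..<length xs}"
    for xs :: "book_vertex list"
    by (auto simp: cycle_edges_def)
  then show "finite (edges (book_graph m n))" by (simp add: book_graph_def)
qed

section \<open>The even edge sets of size m are the pages\<close>

text \<open>A page is a cycle, so a vertex of the book meets either two of its edges or
  none.\<close>

lemma even_edge_set_page:
  assumes "m \<ge> 3" "i \<in> {1..n}"
  shows "even_edge_set (book_graph m n) (cycle_edges (page m i))"
  unfolding even_edge_set_def
proof
  show "cycle_edges (page m i) \<subseteq> edges (book_graph m n)"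
    using assms by (auto simp: book_graph_def)
  show "\<forall>v\<in>verts (book_graph m n). even (card {e \<in> cycle_edges (page m i). v \<in> e})"
  proof
    fix v assume "v \<in> verts (book_graph m n)"
    then consider "v = U" | "v = V" | i' j where "v = W i' j" "1 \<le> j" "j \<le> m - 2"
      by (auto simp: book_graph_def)
    then show "even (card {e \<in> cycle_edges (page m i). v \<in> e})"
    proof cases
      case 1
      have "{e \<in> cycle_edges (page m i). v \<in> e} = {{U, V}, path_edge m i 0}"
        using assms 1 by (auto simp: cycle_edges_page mem_path_edge)
      then show ?thesis using path_edge_neq_UV[of m 0 i] assms by simp
    next
      case 2
      have "{e \<in> cycle_edges (page m i). v \<in> e} = {{U, V}, path_edge m i (m - 2)}"
        using assms 2 by (auto simp: cycle_edges_page mem_path_edge)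
      moreover have "path_edge m i (m - 2) \<noteq> {U, V}"
        using assms by (intro path_edge_neq_UV) auto
      ultimately show ?thesis by simp
    next
      case 3
      have "{e \<in> cycle_edges (page m i). v \<in> e} =
          (if i' = i then {path_edge m i j, path_edge m i (j - 1)} else {})"
        using assms 3 by (auto simp: cycle_edges_page mem_path_edge)
      moreover have "path_edge m i j \<noteq> path_edge m i (j - 1)"
        using assms 3 by (subst path_edge_inject) auto
      ultimately show ?thesis by simp
    qed
  qed
qed

text \<open>An inner vertex meets only two edges of the book, and an even set contains both or
  neither. Membership therefore propagates along the path from position 0.\<close>

lemma even_edge_set_path:
  assumes m: "m \<ge> 3" and i: "i \<in> {1..n}" and F: "even_edge_set (book_graph m n) F" and k: "k < m - 1"
  shows "path_edge m i k \<in> F \<longleftrightarrow> path_edge m i 0 \<in> F"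
  using k
proof (induction k)
  case (Suc k)
  have n: "n \<ge> 1" using i by simp
  let ?v = "W i (Suc k)"
  have "{e \<in> F. ?v \<in> e} = {path_edge m i k, path_edge m i (Suc k)} \<inter> F"
    using F Suc.prems m i unfolding even_edge_set_def edges_book_graph[OF m n]
    by (auto simp: mem_path_edge)
  moreover have "?v \<in> verts (book_graph m n)"
    using i Suc.prems by (auto simp: book_graph_def)
  moreover have "path_edge m i k \<noteq> path_edge m i (Suc k)"
    using m Suc.prems by (simp add: path_edge_inject)
  ultimately have "path_edge m i k \<in> F \<longleftrightarrow> path_edge m i (Suc k) \<in> F"
    using F by (auto simp: even_edge_set_def Int_insert_left split: if_splits)
  then show ?case using Suc by simp
qed simp

lemma even_edge_set_book_graph_iff:
  assumes m: "m \<ge> 3" and n: "n \<ge> 1"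
  shows "even_edge_set (book_graph m n) F \<and> card F = m \<longleftrightarrow>
    F \<in> (\<lambda>i. cycle_edges (page m i)) ` {1..n}"
proof
  assume "F \<in> (\<lambda>i. cycle_edges (page m i)) ` {1..n}"
  then show "even_edge_set (book_graph m n) F \<and> card F = m"
    using m even_edge_set_page card_cycle_edges_page by auto
next
  assume "even_edge_set (book_graph m n) F \<and> card F = m"
  then have F: "even_edge_set (book_graph m n) F" and card: "card F = m" by auto
  have sub: "F \<subseteq> insert {U, V} (\<Union>i\<in>{1..n}. path_edge m i ` {..<m - 1})"
    using F edges_book_graph[OF m n] by (simp add: even_edge_set_def)
  have fin: "finite F" using card m card_ge_0_finite by force
  note path = even_edge_set_path[OF m _ F]
  \<comment> \<open>As \<open>m \<ge> 3\<close>, the set \<open>F\<close> has an edge besides the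
    shared one, hence a whole page path.\<close>
  have "\<not> F \<subseteq> {{U, V}}"
    using card_mono[of "{{U, V}}" F] card m by auto
  then obtain i where i: "i \<in> {1..n}" "path_edge m i 0 \<in> F"
    using sub path by blast
  have uniq: "i' = i" if i': "i' \<in> {1..n}" "path_edge m i' 0 \<in> F" for i'
  proof (rule ccontr)
    assume "i' \<noteq> i"
    then have "path_edge m i ` {..<m - 1} \<inter> path_edge m i' ` {..<m - 1} = {}"
      using m by (auto simp: path_edge_inject)
    then have "card (path_edge m i ` {..<m - 1} \<union> path_edge m i' ` {..<m - 1}) = 2 * (m - 1)"
      by (simp add: card_Un_disjoint card_path_edges[OF m] del: One_nat_def)
    moreover have "path_edge m i ` {..<m - 1} \<union> path_edge m i' ` {..<m - 1} \<subseteq> F"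
      using path i i' by auto
    ultimately have "2 * (m - 1) \<le> m" using card_mono[OF fin] card by metis
    then show False using m by simp
  qed
  \<comment> \<open>Only the path of page \<open>i\<close> can contribute to \<open>F\<close>.
    Comparing sizes then forces the shared edge into \<open>F\<close> as well.\<close>
  have "F \<subseteq> cycle_edges (page m i)"
    unfolding cycle_edges_page[OF m] using sub path uniq by blast
  moreover have "finite (cycle_edges (page m i))" by (simp add: cycle_edges_page[OF m])
  ultimately have "F = cycle_edges (page m i)"
    using card card_cycle_edges_page[OF m, of i] by (intro card_subset_eq) auto
  then show "F \<in> (\<lambda>i. cycle_edges (page m i)) ` {1..n}" using i by blast
qed

section \<open>Normal forms\<close>

text \<open>\<open>P\<close> is the set of negative pages. The first edges are spelled as in the
  signature of the theorem; \<open>path_edge_0\<close> links them to the path numbering.\<close>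

definition normal_book :: "nat \<Rightarrow> nat \<Rightarrow> nat set \<Rightarrow> book_vertex signed_graph" where
  "normal_book m n P = (book_graph m n,
     \<lambda>e\<in>edges (book_graph m n). if e \<in> (\<lambda>i. {U, W i 1}) ` P then -1 else 1)"

lemma signed_graph_normal_book:
  "m \<ge> 3 \<Longrightarrow> signed_graph (normal_book m n P)"
  by (auto simp: signed_graph_def normal_book_def simple_book_graph)

lemma normal_book_in_signed_graphs_on:
  "m \<ge> 3 \<Longrightarrow> normal_book m n P \<in> signed_graphs_on (book_graph m n)"
  using signed_graph_normal_book by (simp add: signed_graphs_on_def) (simp add: normal_book_def)

lemma signature_normal_book:
  "signature (normal_book m n P) \<subseteq> (\<lambda>i. {U, W i 1}) ` P"
  by (auto simp: signature_def normal_book_def)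

text \<open>Once the spanning tree is positive, only first edges of pages can be negative, and
  \<open>P\<close> collects the pages where this happens.\<close>

lemma switching_equivalent_normal_book:
  assumes m: "m \<ge> 3" and n: "n \<ge> 1" and \<sigma>: "signed_graph (book_graph m n, \<sigma>)"
  obtains P where "P \<subseteq> {1..n}" "switching_equivalent (book_graph m n, \<sigma>) (normal_book m n P)"
proof -
  let ?G = "book_graph m n"
  have sgn: "\<sigma> e \<in> {1, -1}" if "e \<in> edges ?G" for e
    using \<sigma> that by (auto simp: signed_graph_def)
  have ext: "\<sigma> \<in> extensional (edges ?G)" using \<sigma> by (auto simp: signed_graph_def PiE_def)
  have edge: "path_edge m i k \<in> edges ?G" if "i \<in> {1..n}" "k < m - 1" for i k
    using that by (auto simp: edges_book_graph[OF m n])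
  have UV: "{U, V} \<in> edges ?G" by (simp add: edges_book_graph[OF m n])
  \<comment> \<open>Switching by the sign of the tree path to V makes every edge of the spanning tree
     (the edge UV and all page edges but the first ones) positive.\<close>
  define s where "s v = (case v of U \<Rightarrow> \<sigma> {U, V} | V \<Rightarrow> 1
    | W i j \<Rightarrow> \<Prod>k\<in>{j..<m - 1}. \<sigma> (path_edge m i k))" for v
  define \<tau> where "\<tau> = (\<lambda>e\<in>edges ?G. prod s e * \<sigma> e)"
  have prod_sgn: "(\<Prod>k\<in>K. \<sigma> (path_edge m i k)) \<in> {1, -1}"
    if "finite K" "K \<subseteq> {..<m - 1}" "i \<in> {1..n}" for i K
    using that
  proof (induction K rule: finite_induct)
    case (insert k K)
    then show ?case using sgn[OF edge[of i k]] by auto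
  qed simp
  have s: "s v \<in> {1, -1}" if "v \<in> verts ?G" for v
  proof -
    consider "v = U" | "v = V" | i j where "v = W i j" "i \<in> {1..n}" "1 \<le> j"
      using \<open>v \<in> verts ?G\<close> by (auto simp: book_graph_def)
    then show ?thesis
    proof cases
      case 1
      then show ?thesis using sgn[OF UV] by (simp add: s_def)
    next
      case 2
      then show ?thesis by (simp add: s_def)
    next
      case 3
      then show ?thesis using prod_sgn[of "{j..<m - 1}" i] by (simp add: s_def subset_eq)
    qed
  qed
  have equiv: "switching_equivalent (?G, \<sigma>) (?G, \<tau>)"
    unfolding \<tau>_def
    by (rule switching_equivalent_switch_fun)
      (use simple_book_graph[OF m] finite_book_graph ext s in auto)
  have sg: "signed_graph (?G, \<tau>)"
    using switching_equivalent_signed_graph[OF equiv \<sigma>] by simp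
  \<comment> \<open>Here \<open>s U\<close> is the sign of this edge and \<open>s V\<close> is 1, so
    the new sign is a square.\<close>
  have \<tau>UV: "\<tau> {U, V} = 1"
    using UV sgn[OF UV] by (auto simp: \<tau>_def s_def)
  have \<tau>path: "\<tau> (path_edge m i k) = 1" if i: "i \<in> {1..n}" and k: "0 < k" "k < m - 1" for i k
  proof -
    let ?p = "\<Prod>k\<in>{Suc k..<m - 1}. \<sigma> (path_edge m i k)"
    let ?e = "path_edge m i k"
    \<comment> \<open>The case \<open>j = m - 1\<close> is the vertex \<open>V\<close>, where the
      empty product agrees with \<open>s V = 1\<close>.\<close>
    have sp: "s (path_vertex m i j) = (\<Prod>k\<in>{j..<m - 1}. \<sigma> (path_edge m i k))"
      if "0 < j" "j \<le> m - 1" for j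
      using that by (auto simp: s_def path_vertex_def)
    \<comment> \<open>The values of \<open>s\<close> at the two ends differ by the factor
      \<open>\<sigma> ?e\<close>, so the switched sign is a product of squares.\<close>
    have "s (path_vertex m i k) = \<sigma> ?e * ?p"
      using sp[of k] k by (simp add: prod.atLeast_Suc_lessThan)
    moreover have "s (path_vertex m i (Suc k)) = ?p"
      using sp[of "Suc k"] k by simp
    moreover have "path_vertex m i k \<noteq> path_vertex m i (Suc k)"
      using k by (auto simp: path_vertex_def)
    ultimately have "prod s ?e = \<sigma> ?e * ?p * ?p" by (simp add: path_edge_def)
    moreover have "?p \<in> {1, -1}" using i by (intro prod_sgn) auto
    ultimately show ?thesis using sgn[OF edge[OF i k(2)]] edge[OF i k(2)]
      by (auto simp: \<tau>_def)
  qed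
  define P where "P = {i \<in> {1..n}. \<tau> {U, W i 1} = -1}"
  have "\<tau> e = (if e \<in> (\<lambda>i. {U, W i 1}) ` P then -1 else 1)" if e: "e \<in> edges ?G" for e
  proof -
    have "\<tau> e \<in> {1, -1}" using sg e by (auto simp: signed_graph_def)
    moreover have "e \<in> (\<lambda>i. {U, W i 1}) ` P" if neq: "\<tau> e \<noteq> 1"
    proof -
      obtain i k where ik: "i \<in> {1..n}" "k < m - 1" "e = path_edge m i k"
        using e neq \<tau>UV unfolding edges_book_graph[OF m n] by blast
      then have "k = 0" using \<tau>path neq by blast
      then have "e = {U, W i 1}" using ik path_edge_0[OF m] by simp
      then show ?thesis using neq \<open>\<tau> e \<in> {1, -1}\<close> ik by (auto simp: P_def)
    qed
    ultimately show ?thesis by (auto simp: P_def)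
  qed
  moreover have "\<tau> \<in> extensional (edges ?G)" by (simp add: \<tau>_def)
  ultimately have "(?G, \<tau>) = normal_book m n P"
    by (auto simp: normal_book_def fun_eq_iff extensional_def)
  moreover have "P \<subseteq> {1..n}" unfolding P_def by blast
  ultimately show ?thesis using that[of P] equiv by argo
qed

text \<open>Among the edges of page \<open>i\<close> only its own first edge can be negative, so the
  page has sign -1 exactly when \<open>i\<close> is in \<open>P\<close>. Distinct pages are distinct
  edge sets.\<close>

lemma card_negative_even_sets_normal_book:
  assumes m: "m \<ge> 3" and n: "n \<ge> 1" and P: "P \<subseteq> {1..n}"
  shows "card (negative_even_sets m (normal_book m n P)) = card P"
proof -
  let ?C = "\<lambda>i. cycle_edges (page m i)"
  define \<tau> where "\<tau> = snd (normal_book m n P)"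
  have "prod \<tau> (?C i) = (if i \<in> P then -1 else 1)" if i: "i \<in> {1..n}" for i
  proof -
    have CE: "?C i \<subseteq> edges (book_graph m n)" using i by (auto simp: book_graph_def)
    \<comment> \<open>A first edge of page \<open>i'\<close> lying on page \<open>i\<close> forces
      \<open>i' = i\<close>.\<close>
    have e: "e = path_edge m i 0" if "e \<in> ?C i" "e = {U, W i' 1}" for e i'
      using that m path_edge_0[OF m, of i'] path_edge_mem_page_iff[OF m, of 0 i' i] by simp
    have "prod \<tau> (?C i) = (\<Prod>e\<in>?C i. if e = path_edge m i 0 then if i \<in> P then -1 else 1 else 1)"
    proof (rule prod.cong)
      fix e assume eC: "e \<in> ?C i"
      have "e \<in> (\<lambda>i. {U, W i 1}) ` P \<longleftrightarrow> e = path_edge m i 0 \<and> i \<in> P"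
        using e[OF eC] path_edge_0[OF m] by (auto simp: doubleton_eq_iff)
      moreover have "\<tau> e = (if e \<in> (\<lambda>i. {U, W i 1}) ` P then -1 else 1)"
        using subsetD[OF CE eC] by (simp only: \<tau>_def normal_book_def snd_conv restrict_apply')
      ultimately show "\<tau> e = (if e = path_edge m i 0 then if i \<in> P then -1 else 1 else 1)"
        by argo
    qed simp
    also have "\<dots> = (if i \<in> P then -1 else 1)"
      using m by (subst prod.delta) (auto simp: cycle_edges_page)
    finally show ?thesis .
  qed
  moreover have "negative_even_sets m (normal_book m n P) = {F \<in> ?C ` {1..n}. prod \<tau> F = -1}"
    using even_edge_set_book_graph_iff[OF m n]
    by (auto simp: negative_even_sets_def \<tau>_def normal_book_def)
  ultimately have "negative_even_sets m (normal_book m n P) = ?C ` P"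
    using P by (auto split: if_splits)
  then show ?thesis
    using inj_cycle_edges_page[OF m] by (simp add: card_image inj_on_subset)
qed

section \<open>Permuting the pages\<close>

primrec permute_pages :: "(nat \<Rightarrow> nat) \<Rightarrow> book_vertex \<Rightarrow> book_vertex" where
  "permute_pages \<pi> U = U"
| "permute_pages \<pi> V = V"
| "permute_pages \<pi> (W i j) = W (\<pi> i) j"

lemma permute_pages_path_edge:
  "permute_pages \<pi> ` path_edge m i k = path_edge m (\<pi> i) k"
  by (simp add: path_edge_def path_vertex_def)

text \<open>A permutation of the page numbers carrying \<open>P\<close> to \<open>Q\<close> induces
  an automorphism of the book that matches the negative first edges.\<close>

lemma signed_isomorphic_normal_book:
  assumes m: "m \<ge> 3" and n: "n \<ge> 1" and P: "P \<subseteq> {1..n}" and Q: "Q \<subseteq> {1..n}"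
    and card: "card P = card Q"
  shows "signed_isomorphic (normal_book m n P) (normal_book m n Q)"
proof -
  let ?G = "book_graph m n"
  obtain \<pi> where \<pi>: "bij_betw \<pi> {1..n} {1..n}" "\<pi> ` P = Q"
    using permutation_between_subsets[of "{1..n}" P Q] P Q card by auto
  have surj: "\<pi> ` {1..n} = {1..n}" and inj: "inj_on \<pi> {1..n}"
    using \<pi> by (auto simp: bij_betw_def)
  let ?f = "permute_pages \<pi>"
  have verts: "verts ?G = {U, V} \<union> (\<lambda>(i, j). W i j) ` ({1..n} \<times> {1..m - 2})"
    by (auto simp: book_graph_def)
  have "?f ` verts ?G = {U, V} \<union> (\<lambda>(i, j). W i j) ` (\<pi> ` {1..n} \<times> {1..m - 2})"
    unfolding verts by force
  then have fsurj: "?f ` verts ?G = verts ?G" unfolding surj verts .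
  have finj: "inj_on ?f (verts ?G)"
  proof (rule inj_onI)
    fix x y assume "x \<in> verts ?G" "y \<in> verts ?G" "?f x = ?f y"
    then show "x = y"
      by (cases x; cases y) (simp_all add: book_graph_def inj_on_eq_iff[OF inj])
  qed
  have "(`) ?f ` edges ?G = insert {U, V} (\<Union>i\<in>\<pi> ` {1..n}. path_edge m i ` {..<m - 1})"
    unfolding edges_book_graph[OF m n]
    by (simp add: image_UN image_image permute_pages_path_edge)
  then have fedges: "(`) ?f ` edges ?G = edges ?G"
    unfolding surj edges_book_graph[OF m n] .
  have sub: "e \<subseteq> verts ?G" if "e \<in> edges ?G" for e
    using simple_book_graph[OF m] that by (auto simp: simple_graph_def)
  \<comment> \<open>The map permutes the edge set and is injective on sets of vertices, so an edge
    is the image of no vertex set other than an edge.\<close>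
  have edge_iff: "?f ` e \<in> edges ?G \<longleftrightarrow> e \<in> edges ?G" if e: "e \<subseteq> verts ?G" for e
  proof
    assume "?f ` e \<in> edges ?G"
    then obtain e' where e': "e' \<in> edges ?G" "?f ` e = ?f ` e'"
      using fedges by (metis imageE)
    then have "e = e'" using inj_on_image_eq_iff[OF finj e sub] by blast
    then show "e \<in> edges ?G" using e' by simp
  qed (use fedges in blast)
  \<comment> \<open>The first edges indexed by \<open>P\<close> are mapped onto those indexed by
    \<open>Q\<close>; injectivity on vertex sets gives the converse.\<close>
  have first: "?f ` e \<in> (\<lambda>i. {U, W i 1}) ` Q \<longleftrightarrow> e \<in> (\<lambda>i. {U, W i 1}) ` P"
    if e: "e \<in> edges ?G" for e
  proof -
    have "?f ` {U, W i 1} = {U, W (\<pi> i) 1}" for i by simp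
    then have im: "(`) ?f ` (\<lambda>i. {U, W i 1}) ` P = (\<lambda>i. {U, W i 1}) ` Q"
      unfolding \<pi>(2)[symmetric] by (simp add: image_image)
    have "(\<lambda>i. {U, W i 1}) ` P \<subseteq> Pow (verts ?G)" using P m by (auto simp: verts)
    moreover have "e \<in> Pow (verts ?G)" using sub[OF e] by blast
    ultimately show ?thesis
      unfolding im[symmetric] by (intro inj_on_image_mem_iff[OF inj_on_image_Pow[OF finj]])
  qed
  have "signed_isomorphism ?f (normal_book m n P) (normal_book m n Q)"
    unfolding signed_isomorphism_def normal_book_def prod.case
  proof (intro conjI ballI)
    show "bij_betw ?f (verts ?G) (verts ?G)" using fsurj finj by (simp add: bij_betw_def)
  next
    fix x y assume "x \<in> verts ?G" "y \<in> verts ?G"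
    then show "{x, y} \<in> edges ?G \<longleftrightarrow> {?f x, ?f y} \<in> edges ?G"
      using edge_iff[of "{x, y}"] by simp
  next
    fix e assume e: "e \<in> edges ?G"
    then show "restrict (\<lambda>e. if e \<in> (\<lambda>i. {U, W i 1}) ` Q then - 1 else 1) (edges ?G) (?f ` e) =
        restrict (\<lambda>e. if e \<in> (\<lambda>i. {U, W i 1}) ` P then - 1 else 1 :: int) (edges ?G) e"
      using edge_iff[OF sub[OF e]] first[OF e] by simp
  qed
  then show ?thesis by (auto simp: signed_isomorphic_def)
qed

theorem theorem2p1:
  fixes m n :: nat
  assumes "m \<ge> 3" and "n \<ge> 1"
  shows "(\<forall>\<sigma>. signed_graph (book_graph m n, \<sigma>) \<longrightarrow>
            (\<exists>\<tau>. signed_graph (book_graph m n, \<tau>) \<and>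
                 signature (book_graph m n, \<tau>) \<subseteq> {{U, W i 1} |i. i \<in> {1..n}} \<and>
                 switching_equivalent (book_graph m n, \<sigma>) (book_graph m n, \<tau>)))
         \<and> card (signed_graphs_on (book_graph m n) //
                 switching_isomorphism_on (book_graph m n)) = n + 1"
proof (intro conjI allI impI)
  fix \<sigma> assume "signed_graph (book_graph m n, \<sigma>)"
  then obtain P where P: "P \<subseteq> {1..n}"
    "switching_equivalent (book_graph m n, \<sigma>) (normal_book m n P)"
    using switching_equivalent_normal_book assms by blast
  obtain \<tau> where \<tau>: "normal_book m n P = (book_graph m n, \<tau>)"
    by (simp add: normal_book_def)
  show "\<exists>\<tau>. signed_graph (book_graph m n, \<tau>) \<and>
      signature (book_graph m n, \<tau>) \<subseteq> {{U, W i 1} |i. i \<in> {1..n}} \<and>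
      switching_equivalent (book_graph m n, \<sigma>) (book_graph m n, \<tau>)"
    using P signed_graph_normal_book[OF assms(1), of n P] signature_normal_book[of m n P]
    unfolding \<tau> by (intro exI[of _ \<tau>]) blast
next
  let ?G = "book_graph m n"
  let ?A = "signed_graphs_on ?G"
  let ?N = "\<lambda>S. card (negative_even_sets m S)"
  note fin = finite_book_graph[of m n]
  \<comment> \<open>Links the two halves of the argument: the invariant of \<open>S\<close> is the
    size of \<open>P\<close> in any normal form reached from \<open>S\<close>.\<close>
  have normal: "\<exists>P\<subseteq>{1..n}. switching_equivalent S (normal_book m n P) \<and> ?N S = card P"
    if S: "S \<in> ?A" for S
  proof -
    obtain \<sigma> where \<sigma>: "S = (?G, \<sigma>)" "signed_graph (?G, \<sigma>)"
      using S by (cases S) (auto simp: signed_graphs_on_def)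
    obtain P where P: "P \<subseteq> {1..n}" "switching_equivalent S (normal_book m n P)"
      using switching_equivalent_normal_book[OF assms \<sigma>(2)] \<sigma>(1) by blast
    have "?N S = ?N (normal_book m n P)"
      using negative_even_sets_switching[OF P(2)] fin \<sigma> by simp
    then show ?thesis using P card_negative_even_sets_normal_book[OF assms P(1)] by auto
  qed
  have "?N ` ?A = {0..n}"
  proof (intro equalityI subsetI)
    fix k assume "k \<in> ?N ` ?A"
    then obtain P where "P \<subseteq> {1..n}" "k = card P" using normal by blast
    then show "k \<in> {0..n}" using card_mono[of "{1..n}" P] by simp
  next
    fix k assume "k \<in> {0..n}"
    \<comment> \<open>Making the first \<open>k\<close> pages negative realizes the value
      \<open>k\<close>.\<close>
    then have "?N (normal_book m n {1..k}) = k"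
      using card_negative_even_sets_normal_book[OF assms, of "{1..k}"] by simp
    then show "k \<in> ?N ` ?A"
      using normal_book_in_signed_graphs_on[OF assms(1)] by (metis image_eqI)
  qed
  moreover have "(S, T) \<in> switching_isomorphism_on ?G \<longleftrightarrow> ?N S = ?N T"
    if S: "S \<in> ?A" and T: "T \<in> ?A" for S T
  proof
    assume "(S, T) \<in> switching_isomorphism_on ?G"
    then show "?N S = ?N T"
      using S T fin by (intro card_negative_even_sets_switching_isomorphic)
        (auto simp: switching_isomorphism_on_def signed_graphs_on_def)
  next
    \<comment> \<open>Completeness of the invariant: \<open>S\<close> is linked to \<open>T\<close>
      through their normal forms, which are isomorphic because \<open>P\<close> and \<open>Q\<close>
      have equal size.\<close>
    assume eq: "?N S = ?N T"
    obtain P Q where P: "P \<subseteq> {1..n}" "switching_equivalent S (normal_book m n P)" "?N S = card P"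
      and Q: "Q \<subseteq> {1..n}" "switching_equivalent T (normal_book m n Q)" "?N T = card Q"
      using normal[OF S] normal[OF T] by blast
    have sg: "signed_graph S" "signed_graph T" using S T by (auto simp: signed_graphs_on_def)
    let ?P = "normal_book m n P" and ?Q = "normal_book m n Q"
    have "signed_isomorphic ?P ?Q"
      using signed_isomorphic_normal_book assms P Q eq by simp
    then have PT: "switching_isomorphic ?P T"
      using Q(2) unfolding switching_isomorphic_def by blast
    \<comment> \<open>The definition switches the second argument, so the switching from
      \<open>S\<close> to \<open>?P\<close> is reversed first.\<close>
    have "switching_isomorphic S ?P"
      using switching_equivalent_sym[OF P(2) sg(1)] signed_isomorphic_refl
      unfolding switching_isomorphic_def by blast
    then have "switching_isomorphic S T"
      using PT switching_isomorphic_trans sg signed_graph_normal_book[OF assms(1)] by blast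
    then show "(S, T) \<in> switching_isomorphism_on ?G"
      using S T by (simp add: switching_isomorphism_on_def)
  qed
  ultimately show "card (?A // switching_isomorphism_on ?G) = n + 1"
    using card_quotient_eq_card_image[OF equiv_switching_isomorphism_on, of ?G ?N] by simp
qed

end
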